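(* Let $G$ be a connected undirected graph on $n$ vertices, with no loops but possibly multiple edges, and let $|E(G)|$ denote its number of edges (counted with multiplicity). Then \[\#A(G) \leq \frac{n!}{2} \cdot |E(G)|^{2^{n-2} - 1} \cdot |E(G)|^{2^{n-1} \cdot \frac{1.538\log(2)}{(n-1)\log(2) + \log(\log(|E(G)|))}}.\]
   Context: Let the vertices of $G$ be $v_1,\dots,v_n$ and let $\delta_{ij}$ be the number of edges between $v_i$ and $v_j$ ($\delta_{ii}=0$). An arithmetical structure on $G$ is a pair $(\mathbf r,\mathbf d)\in\mathbb N^n\times\mathbb N^n$ of vectors of positive integers with $\gcd(r_1,\dots,r_n)=1$ such that $r_i d_i=\sum_{j\neq i} r_j\delta_{ij}$ for every $i$. Since $\mathbf d$ is determined by $\mathbf r$, one identifies the structure with $\mathbf r$. $A(G)$ denotes the set of arithmetical structures on $G$ (vertices are labeled, so structures differing by a permutation of coordinates are counted separately). $\log$ is the natural logarithm. *)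

theory Defs
  imports Complex_Main "HOL-Library.FuncSet"
begin

text \<open>
  Finite undirected multigraphs without loops: \<open>E\<close> is a set of edges (as individual objects, so
  parallel edges are distinct elements), and \<open>ends e\<close> is the set of the two endpoints of \<open>e\<close>.
\<close>

locale loopless_multigraph =
  fixes V :: "'v set" and E :: "'e set" and ends :: "'e \<Rightarrow> 'v set"
  assumes finite_V: "finite V"
    and finite_E: "finite E"
    and ends_subset: "\<And>e. e \<in> E \<Longrightarrow> ends e \<subseteq> V"
    and card_ends: "\<And>e. e \<in> E \<Longrightarrow> card (ends e) = 2"

definition edge_mult :: "'e set \<Rightarrow> ('e \<Rightarrow> 'v set) \<Rightarrow> 'v \<Rightarrow> 'v \<Rightarrow> nat" where
  "edge_mult E ends u v = card {e \<in> E. ends e = {u, v}}"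

lemma (in loopless_multigraph) edge_mult_self: "edge_mult E ends v v = 0"
proof -
  have "{e \<in> E. ends e = {v, v}} = {}"
    using card_ends by force
  then show ?thesis
    unfolding edge_mult_def by (simp only: card.empty)
qed

definition multigraph_connected :: "'v set \<Rightarrow> 'e set \<Rightarrow> ('e \<Rightarrow> 'v set) \<Rightarrow> bool" where
  "multigraph_connected V E ends \<longleftrightarrow>
     V \<noteq> {} \<and> (\<forall>u\<in>V. \<forall>v\<in>V. (u, v) \<in> {(x, y). \<exists>e\<in>E. ends e = {x, y}}\<^sup>*)"

text \<open>
  Vectors indexed by the vertices are extensional functions on \<open>V\<close>, so that two structures are
  equal iff they agree at every vertex.
\<close>

definition arith_structures ::
  "'v set \<Rightarrow> 'e set \<Rightarrow> ('e \<Rightarrow> 'v set) \<Rightarrow> (('v \<Rightarrow> nat) \<times> ('v \<Rightarrow> nat)) set" where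
  "arith_structures V E ends =
     {(r, d). r \<in> V \<rightarrow>\<^sub>E {0<..} \<and> d \<in> V \<rightarrow>\<^sub>E {0<..} \<and> Gcd (r ` V) = 1 \<and>
        (\<forall>v\<in>V. r v * d v = (\<Sum>u\<in>V - {v}. r u * edge_mult E ends v u))}"

end

theory Submission
  imports Defs "HOL-Analysis.Harmonic_Numbers" "HOL-Computational_Algebra.Primes"
begin

text \<open>
  Given a structure \<open>(r, d)\<close>, eliminate the variable at a vertex \<open>x\<close> where \<open>r\<close> is maximal. The
  remaining coordinates, divided by their gcd, form a structure on the graph with vertex set
  \<open>V - {x}\<close> and edge multiplicities \<open>d x * \<delta> u v + \<delta> u x * \<delta> x v\<close>, and the original structure
  can be recovered from it together with \<open>x\<close> and \<open>d x\<close>. Maximality gives \<open>d x \<le> deg x \<le> m\<close>, so there are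
  at most \<open>n * m\<close> choices for \<open>(x, d x)\<close>, and the new graph has at most \<open>m\<^sup>2\<close> edges. Iterating down to two
  vertices joined by \<open>j\<close> edges, where the structures are the pairs of coprime divisors of \<open>j\<close> and so
  correspond to divisors of \<open>j\<^sup>2\<close>, leaves a bound for the number of divisors of \<open>j\<^sup>2\<close> with
  \<open>j \<le> m ^ 2 ^ (n - 2)\<close>.

  For that bound, \<open>\<Prod>p. 2 * a p + 1\<close> is compared with \<open>j powr \<epsilon>\<close> one prime at a time. Since \<open>2 * a + 1 \<le> 3 ^ a\<close>,
  only primes with \<open>p powr \<epsilon> < 3\<close> contribute to the constant. The exponents \<open>1/2\<close>, \<open>1/3\<close>, \<open>1/4\<close> cover
  \<open>ln j \<le> 2048\<close>. Beyond that \<open>\<epsilon> = ln 3 / ln P\<close> with \<open>P\<close> one eighth of \<open>ln j\<close> works, and counting all integers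
  below \<open>P\<close> instead of the primes is good enough. Only squares occur, which is why these crude estimates
  reach the constant \<open>1.538\<close> of Nicolas and Robin.
\<close>

section \<open>The number of divisors of a square\<close>

lemma card_divisors_prime_power_mult_le:
  fixes p N b :: nat
  assumes "prime p" "N > 0"
  shows "card {d. d dvd p ^ b * N} \<le> (b + 1) * card {d. d dvd N}"
proof -
  have fin: "finite {d. d dvd N}" using assms by simp
  have "{d. d dvd p ^ b * N} \<subseteq> (\<lambda>(i, e). p ^ i * e) ` ({..b} \<times> {d. d dvd N})"
  proof
    fix d assume "d \<in> {d. d dvd p ^ b * N}"
    then obtain x e where de: "d = x * e" "x dvd p ^ b" "e dvd N"
      using division_decomp by blast
    then obtain i where "i \<le> b" "x = p ^ i"
      using divides_primepow_nat[OF assms(1)] by blast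
    then show "d \<in> (\<lambda>(i, e). p ^ i * e) ` ({..b} \<times> {d. d dvd N})"
      using de by force
  qed
  then have "card {d. d dvd p ^ b * N} \<le> card ({..b} \<times> {d. d dvd N})"
    using fin by (meson finite_SigmaI finite_atMost surj_card_le)
  then show ?thesis by (simp add: card_cartesian_product)
qed

lemma card_divisors_prod_prime_powers_le:
  fixes S :: "nat set" and b :: "nat \<Rightarrow> nat"
  assumes "finite S" "\<And>p. p \<in> S \<Longrightarrow> prime p"
  shows "card {d. d dvd (\<Prod>p\<in>S. p ^ b p)} \<le> (\<Prod>p\<in>S. b p + 1)"
  using assms
proof (induction S rule: finite_induct)
  case empty
  then show ?case by simp
next
  case (insert p S)
  have "(\<Prod>q\<in>S. q ^ b q) > 0"
    using insert.prems by (intro prod_pos) (auto simp: prime_gt_0_nat)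
  then have "card {d. d dvd p ^ b p * (\<Prod>q\<in>S. q ^ b q)}
      \<le> (b p + 1) * card {d. d dvd (\<Prod>q\<in>S. q ^ b q)}"
    using insert.prems by (intro card_divisors_prime_power_mult_le) auto
  also have "\<dots> \<le> (b p + 1) * (\<Prod>q\<in>S. b q + 1)"
    using insert by (intro mult_left_mono) auto
  finally show ?case using insert.hyps by simp
qed

lemma card_divisors_square_le:
  fixes m :: nat
  assumes "m > 0"
  shows "card {d. d dvd m\<^sup>2} \<le> (\<Prod>p\<in>prime_factors m. 2 * multiplicity p m + 1)"
proof -
  have "m\<^sup>2 = (\<Prod>p\<in>prime_factors m. p ^ multiplicity p m)\<^sup>2"
    using assms by (metis prime_factorization_nat)
  also have "\<dots> = (\<Prod>p\<in>prime_factors m. p ^ (2 * multiplicity p m))"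
    by (simp add: prod_power_distrib power_mult[symmetric] mult.commute)
  finally show ?thesis
    using card_divisors_prod_prime_powers_le[of "prime_factors m" "\<lambda>p. 2 * multiplicity p m"]
    by auto
qed

text \<open>After taking logarithms, each prime of \<open>m\<close> is compared separately with
  \<open>a * \<epsilon> * ln p\<close>, up to a correction \<open>b p\<close>. Composite elements of
  \<open>T\<close> only add nonnegative corrections, so \<open>T\<close> may later be a full
  interval of integers.\<close>

lemma ln_card_divisors_square_le:
  fixes m :: nat and \<epsilon> :: real and b :: "nat \<Rightarrow> real" and T :: "nat set"
  assumes "m > 0" "finite T"
    and bound: "\<And>p a. prime p \<Longrightarrow> p \<in> T \<Longrightarrow> ln (2 * real a + 1) \<le> b p + real a * (\<epsilon> * ln p)"
    and outside: "\<And>p a. prime p \<Longrightarrow> p \<notin> T \<Longrightarrow> ln (2 * real a + 1) \<le> real a * (\<epsilon> * ln p)"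
    and nonneg: "\<And>p. p \<in> T \<Longrightarrow> b p \<ge> 0"
  shows "ln (card {d. d dvd m\<^sup>2}) \<le> (\<Sum>p\<in>T. b p) + \<epsilon> * ln m"
proof -
  let ?F = "prime_factors m" and ?a = "\<lambda>p. multiplicity p m"
  have pos: "real (card {d. d dvd m\<^sup>2}) > 0"
    using assms(1) by (auto simp: card_gt_0_iff)
  have "ln (card {d. d dvd m\<^sup>2}) \<le> ln (real (\<Prod>p\<in>?F. 2 * ?a p + 1))"
    using card_divisors_square_le[OF assms(1)] pos
    by (intro ln_mono) (simp_all only: of_nat_le_iff)
  also have "\<dots> = (\<Sum>p\<in>?F. ln (2 * real (?a p) + 1))"
    by (simp add: ln_prod add.commute)
  also have "\<dots> \<le> (\<Sum>p\<in>?F. (if p \<in> T then b p else 0) + real (?a p) * (\<epsilon> * ln p))"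
    by (rule sum_mono) (auto intro: bound outside)
  also have "\<dots> = (\<Sum>p\<in>?F \<inter> T. b p) + \<epsilon> * (\<Sum>p\<in>?F. real (?a p) * ln p)"
    by (simp add: sum.distrib sum.inter_restrict sum_distrib_left mult_ac)
  also have "(\<Sum>p\<in>?F. real (?a p) * ln p) = ln (real (\<Prod>p\<in>?F. p ^ ?a p))"
    unfolding of_nat_prod by (subst ln_prod) (auto simp: prime_gt_0_nat ln_realpow in_prime_factors_iff)
  also have "(\<Prod>p\<in>?F. p ^ ?a p) = m"
    using assms(1) by (metis prime_factorization_nat)
  also have "(\<Sum>p\<in>?F \<inter> T. b p) \<le> (\<Sum>p\<in>T. b p)"
    using assms(2) nonneg by (intro sum_mono2) auto
  finally show ?thesis by simp
qed

section \<open>Divisor bounds with exponents 1/2, 1/3 and 1/4\<close>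

text \<open>The ratio \<open>((2 * a + 3) / (2 * a + 1)) ^ k\<close> of successive left sides
  decreases in \<open>a\<close>. Once it is at most \<open>x\<close> at \<open>a0\<close>, the
  inequality propagates upwards from there.\<close>

lemma odd_power_le:
  fixes c x :: real and k a0 a :: nat
  assumes base: "\<And>a. a \<le> a0 \<Longrightarrow> (2 * real a + 1) ^ k \<le> c * x ^ a"
    and step: "(1 + 2 / (2 * real a0 + 1)) ^ k \<le> x"
  shows "(2 * real a + 1) ^ k \<le> c * x ^ a"
proof (cases "a \<le> a0")
  case False
  then have "a0 \<le> a" by simp
  then show ?thesis
  proof (induction a rule: dec_induct)
    case base
    then show ?case using assms(1) by simp
  next
    case (step i)
    have "2 * real (Suc i) + 1 \<le> (2 * real i + 1) * (1 + 2 / (2 * real a0 + 1))"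
    proof -
      have "(2 * real i + 1) * (2 / (2 * real a0 + 1)) \<ge> 2"
        using step.hyps by (simp add: field_simps)
      then show ?thesis by (simp add: algebra_simps)
    qed
    then have "(2 * real (Suc i) + 1) ^ k \<le> ((2 * real i + 1) * (1 + 2 / (2 * real a0 + 1))) ^ k"
      by (intro power_mono) auto
    also have "\<dots> = (2 * real i + 1) ^ k * (1 + 2 / (2 * real a0 + 1)) ^ k"
      by (rule power_mult_distrib)
    also have "\<dots> \<le> (c * x ^ i) * x"
      using step.IH assms(2) by (intro mult_mono order_trans[OF zero_le_power step.IH]) auto
    finally show ?case by (simp add: mult_ac)
  qed
qed (use base in auto)

text \<open>Here the exponent is \<open>1 / k\<close> and the correction is
  \<open>ln (c p) / k\<close>. Raising to the \<open>k\<close>-th power leaves rational arithmetic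
  only, and \<open>prod\<close> replaces the sum of the corrections by a comparison with a power of
  two. A prime \<open>p >= 3 ^ k\<close> needs no correction because
  \<open>(2 * a + 1) ^ k <= 3 ^ (k * a) <= p ^ a\<close>.\<close>

lemma ln_card_divisors_square_le_root:
  fixes m k i j :: nat and c :: "nat \<Rightarrow> real" and T :: "nat set"
  assumes "m > 0" "finite T" "k > 0" "j > 0"
    and bound: "\<And>p a. p \<in> T \<Longrightarrow> (2 * real a + 1) ^ k \<le> c p * real p ^ a"
    and outside: "\<And>p. prime p \<Longrightarrow> p \<notin> T \<Longrightarrow> 3 ^ k \<le> p"
    and prod: "(\<Prod>p\<in>T. c p) ^ j \<le> 2 ^ i"
  shows "ln (card {d. d dvd m\<^sup>2}) \<le> real i / (j * k) * ln 2 + ln m / k"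
proof -
  have c1: "c p \<ge> 1" if "p \<in> T" for p
    using bound[OF that, of 0] by simp
  have logs: "ln (2 * real a + 1) \<le> ln C / k + real a * (1 / k * ln p)"
    if "(2 * real a + 1) ^ k \<le> C * real p ^ a" "prime p" "C \<ge> 1" for C p a
  proof -
    have p: "real p > 0" using that(2) prime_gt_0_nat by simp
    have "ln ((2 * real a + 1) ^ k) \<le> ln (C * real p ^ a)"
      using that p by (subst ln_le_cancel_iff) auto
    also have "\<dots> = ln C + a * ln p"
      using that p by (simp add: ln_mult ln_realpow)
    finally have "k * ln (2 * real a + 1) \<le> ln C + a * ln p"
      by (simp add: ln_realpow)
    then show ?thesis using \<open>k > 0\<close> by (simp add: field_simps)
  qed
  have "ln (card {d. d dvd m\<^sup>2}) \<le> (\<Sum>p\<in>T. ln (c p) / k) + 1 / k * ln m"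
  proof (rule ln_card_divisors_square_le[OF assms(1,2)])
    fix p a :: nat assume p: "prime p" "p \<notin> T"
    have "(3::nat) ^ k \<le> p" using outside[OF p] .
    then have three: "(3::real) ^ k \<le> real p"
      by (metis of_nat_le_iff of_nat_numeral of_nat_power)
    have "(2 * real a + 1) ^ k \<le> 1 * real p ^ a"
      by (rule odd_power_le[where ?a0.0 = 0]) (use three in auto)
    from logs[OF this p(1)] show "ln (2 * real a + 1) \<le> real a * (1 / k * ln p)"
      by simp
  qed (use logs[OF bound] c1 in auto)
  also have "(\<Sum>p\<in>T. ln (c p) / k) = ln (\<Prod>p\<in>T. c p) / k"
  proof -
    have "ln (\<Prod>p\<in>T. c p) = (\<Sum>p\<in>T. ln (c p))"
      by (rule ln_prod) (use assms(2) c1 in force)+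
    then show ?thesis by (simp add: sum_divide_distrib)
  qed
  also have "ln (\<Prod>p\<in>T. c p) \<le> real i / j * ln 2"
  proof -
    have pos: "(\<Prod>p\<in>T. c p) > 0" using c1 by (intro prod_pos) fastforce
    have "ln ((\<Prod>p\<in>T. c p) ^ j) \<le> ln (2 ^ i)"
      using prod pos by (subst ln_le_cancel_iff) auto
    then show ?thesis using \<open>j > 0\<close> pos by (simp add: ln_realpow field_simps)
  qed
  finally show ?thesis using \<open>k > 0\<close> by (simp add: field_simps)
qed

text \<open>The quotient \<open>(2 * a + 1) ^ k / x ^ a\<close> is largest at \<open>a = 1\<close>:
  the upper bound on \<open>x\<close> settles \<open>a = 0\<close>, the lower bound makes the
  quotient nonincreasing from \<open>a = 1\<close> on.\<close>

lemma odd_power_le_one: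
  fixes x :: real and k a :: nat
  assumes "x > 0" "(5 / 3) ^ k \<le> x" "x \<le> 3 ^ k"
  shows "(2 * real a + 1) ^ k \<le> 3 ^ k / x * x ^ a"
  by (rule odd_power_le[where ?a0.0 = 1]) (use assms in \<open>auto simp: le_Suc_eq\<close>)

text \<open>The number 81 is \<open>3 ^ 4\<close>, the largest threshold \<open>3 ^ k\<close> needed
  for \<open>k\<close> = 2, 3, 4.\<close>

lemma prime_less_81:
  fixes p :: nat
  assumes "prime p" "p < 81"
  shows "p \<in> {2, 3, 5, 7, 11, 13, 17, 19, 23, 29, 31, 37, 41, 43, 47, 53, 59, 61, 67, 71, 73, 79}"
proof -
  have "\<forall>p\<in>{..<81::nat}. prime p \<longrightarrow>
      p \<in> {2, 3, 5, 7, 11, 13, 17, 19, 23, 29, 31, 37, 41, 43, 47, 53, 59, 61, 67, 71, 73, 79}"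
    by code_simp
  then show ?thesis using assms by blast
qed

text \<open>
  In the next three lemmas the constant of a prime \<open>p\<close> is the maximum of \<open>(2 * a + 1) ^ k / p ^ a\<close>,
  attained at \<open>a = 1\<close> unless \<open>p < (5 / 3) ^ k\<close>.
\<close>
lemma ln_card_divisors_square_le_root2:
  fixes m :: nat
  assumes "m > 0"
  shows "ln (card {d. d dvd m\<^sup>2}) \<le> 11 / 4 * ln 2 + 1 / 2 * ln m"
proof -
  let ?c = "\<lambda>p::nat. if p = 2 then 25 / 4 else 3 ^ 2 / p :: real"
  have two: "(2 * real a + 1) ^ 2 \<le> 25 / 4 * 2 ^ a" for a
    by (rule odd_power_le[where ?a0.0 = 2]) (auto simp: le_Suc_eq numeral_2_eq_2 field_simps)
  \<comment> \<open>The product of the four constants is about 43.4, and its square is below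
    \<open>2 ^ 11\<close>.\<close>
  have "ln (card {d. d dvd m\<^sup>2}) \<le> real 11 / real (2 * 2) * ln 2 + ln m / real 2"
  proof (rule ln_card_divisors_square_le_root[where c = ?c and T = "{2, 3, 5, 7}"])
    show "(2 * real a + 1) ^ 2 \<le> ?c p * real p ^ a" if "p \<in> {2, 3, 5, 7}" for p a
      using that two odd_power_le_one[of "real p" 2 a] by (auto simp: power_divide)
    show "3 ^ 2 \<le> p" if "prime p" "p \<notin> {2, 3, 5, 7}" for p :: nat
      using that prime_less_81[of p] by (cases "p < 81") auto
  qed (use assms in \<open>auto simp: power_divide\<close>)
  then show ?thesis by simp
qed

lemma ln_card_divisors_square_le_root3:
  fixes m :: nat
  assumes "m > 0"
  shows "ln (card {d. d dvd m\<^sup>2}) \<le> 35 / 6 * ln 2 + 1 / 3 * ln m"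
proof -
  let ?c = "\<lambda>p::nat. if p = 2 then 729 / 16 else if p = 3 then 125 / 9 else 3 ^ 3 / p :: real"
  let ?T = "{2, 3, 5, 7, 11, 13, 17, 19, 23} :: nat set"
  have two: "(2 * real a + 1) ^ 3 \<le> 729 / 16 * 2 ^ a" for a
    by (rule odd_power_le[where ?a0.0 = 4]) (auto simp: le_Suc_eq eval_nat_numeral field_simps)
  have three: "(2 * real a + 1) ^ 3 \<le> 125 / 9 * 3 ^ a" for a
    by (rule odd_power_le[where ?a0.0 = 2]) (auto simp: le_Suc_eq eval_nat_numeral field_simps)
  have "ln (card {d. d dvd m\<^sup>2}) \<le> real 35 / real (2 * 3) * ln 2 + ln m / real 3"
  proof (rule ln_card_divisors_square_le_root[where c = ?c and T = ?T])
    show "(2 * real a + 1) ^ 3 \<le> ?c p * real p ^ a" if "p \<in> ?T" for p a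
      using that two three odd_power_le_one[of "real p" 3 a] by (auto simp: power_divide)
    show "3 ^ 3 \<le> p" if "prime p" "p \<notin> ?T" for p :: nat
      using that prime_less_81[of p] by (cases "p < 81") auto
  qed (use assms in \<open>auto simp: power_divide\<close>)
  then show ?thesis by simp
qed

lemma ln_card_divisors_square_le_root4:
  fixes m :: nat
  assumes "m > 0"
  shows "ln (card {d. d dvd m\<^sup>2}) \<le> 45 / 4 * ln 2 + 1 / 4 * ln m"
proof -
  \<comment> \<open>The special values are \<open>11 ^ 4 / 2 ^ 5\<close>,
    \<open>7 ^ 4 / 3 ^ 3\<close>, \<open>5 ^ 4 / 5 ^ 2\<close> and \<open>5 ^ 4 / 7 ^ 2\<close>. The
    exponents of the primes in the denominators are the values of \<open>a0\<close> below.\<close>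
  let ?c = "\<lambda>p::nat. if p = 2 then 14641 / 32 else if p = 3 then 2401 / 27
    else if p = 5 then 25 else if p = 7 then 625 / 49 else 3 ^ 4 / p :: real"
  let ?T = "{2, 3, 5, 7, 11, 13, 17, 19, 23, 29, 31, 37, 41, 43, 47, 53, 59, 61, 67, 71, 73, 79} :: nat set"
  have two: "(2 * real a + 1) ^ 4 \<le> 14641 / 32 * 2 ^ a" for a
    by (rule odd_power_le[where ?a0.0 = 5]) (auto simp: le_Suc_eq eval_nat_numeral field_simps)
  have three: "(2 * real a + 1) ^ 4 \<le> 2401 / 27 * 3 ^ a" for a
    by (rule odd_power_le[where ?a0.0 = 3]) (auto simp: le_Suc_eq eval_nat_numeral field_simps)
  have five: "(2 * real a + 1) ^ 4 \<le> 25 * 5 ^ a" for a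
    by (rule odd_power_le[where ?a0.0 = 2]) (auto simp: le_Suc_eq eval_nat_numeral field_simps)
  have seven: "(2 * real a + 1) ^ 4 \<le> 625 / 49 * 7 ^ a" for a
    by (rule odd_power_le[where ?a0.0 = 2]) (auto simp: le_Suc_eq eval_nat_numeral field_simps)
  have "ln (card {d. d dvd m\<^sup>2}) \<le> real 45 / real (1 * 4) * ln 2 + ln m / real 4"
  proof (rule ln_card_divisors_square_le_root[where c = ?c and T = ?T])
    show "(2 * real a + 1) ^ 4 \<le> ?c p * real p ^ a" if "p \<in> ?T" for p a
      using that two three five seven odd_power_le_one[of "real p" 4 a] by (auto simp: power_divide)
    show "3 ^ 4 \<le> p" if "prime p" "p \<notin> ?T" for p :: nat
      using that prime_less_81[of p] by (cases "p < 81") auto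
  qed (use assms in \<open>auto simp: power_divide\<close>)
  then show ?thesis by simp
qed

section \<open>Numerical estimates and the range of \<open>y\<close> up to 2048\<close>

lemma ln_2_bounds: "6931 / 10000 \<le> ln (2::real)" "ln (2::real) \<le> 6932 / 10000"
  using ln_approx_bounds[of 2 4]
  by (auto simp: lessThan_nat_numeral lessThan_Suc power_divide)

lemma ln_3_bounds: "109 / 100 \<le> ln (3::real)" "ln (3::real) \<le> 1099 / 1000"
proof -
  have "41 * ln (3::real) = ln (3 ^ 41)" "65 * ln (2::real) = ln (2 ^ 65)"
    by (simp_all only: ln_realpow zero_less_numeral of_nat_numeral)
  moreover have "ln (3 ^ 41 :: real) \<le> ln (2 ^ 65)"
    by (subst ln_le_cancel_iff) auto
  ultimately show "ln (3::real) \<le> 1099 / 1000" using ln_2_bounds by linarith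
  have "12 * ln (3::real) = ln (3 ^ 12)" "19 * ln (2::real) = ln (2 ^ 19)"
    by (simp_all only: ln_realpow zero_less_numeral of_nat_numeral)
  moreover have "ln (2 ^ 19 :: real) \<le> ln (3 ^ 12)"
    by (subst ln_le_cancel_iff) auto
  ultimately show "109 / 100 \<le> ln (3::real)" using ln_2_bounds by linarith
qed

lemma ln_le_tangent:
  fixes x s :: real
  assumes "x > 0" "s > 0"
  shows "ln x \<le> ln s + x / s - 1"
  using ln_le_minus_one[of "x / s"] assms by (simp add: ln_div)

text \<open>On the interval the quadratic lies below its chord by
  \<open>A * (y - lo) * (hi - y)\<close>; the identity in the proof is this fact multiplied by
  \<open>hi - lo\<close>.\<close>

lemma convex_quadratic_nonpos:
  fixes A B C lo hi y :: real
  assumes "A \<ge> 0" "lo \<le> y" "y \<le> hi"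
    and "A * lo\<^sup>2 + B * lo + C \<le> 0" "A * hi\<^sup>2 + B * hi + C \<le> 0"
  shows "A * y\<^sup>2 + B * y + C \<le> 0"
proof (cases "lo = hi")
  case False
  then have lt: "hi - lo > 0" using assms by simp
  have "(hi - lo) * (A * y\<^sup>2 + B * y + C)
      = (hi - y) * (A * lo\<^sup>2 + B * lo + C) + (y - lo) * (A * hi\<^sup>2 + B * hi + C)
        - A * (hi - lo) * (y - lo) * (hi - y)"
    by (simp add: power2_eq_square algebra_simps)
  moreover have "(hi - y) * (A * lo\<^sup>2 + B * lo + C) \<le> 0" "(y - lo) * (A * hi\<^sup>2 + B * hi + C) \<le> 0"
    using assms by (auto intro: mult_nonneg_nonpos)
  moreover have "A * (hi - lo) * (y - lo) * (hi - y) \<ge> 0"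
    using assms lt by simp
  ultimately have "(hi - lo) * (A * y\<^sup>2 + B * y + C) \<le> 0" by linarith
  then show ?thesis using lt by (simp add: mult_le_0_iff)
qed (use assms in auto)

text \<open>
  Replacing \<open>ln (2 * y)\<close> by its tangent at \<open>2 ^ j\<close> makes the claim a convex quadratic inequality,
  which only has to be checked at the ends of the interval.
\<close>
lemma affine_mult_ln_le:
  fixes A e y lo hi c :: real and j :: nat
  assumes "0 < lo" "lo \<le> y" "y \<le> hi" "A \<ge> 0" "e \<ge> 0"
    and "(A + e * lo) * (6932 / 10000 * real j - 1 + 2 * lo / 2 ^ j) \<le> c * lo"
    and "(A + e * hi) * (6932 / 10000 * real j - 1 + 2 * hi / 2 ^ j) \<le> c * hi"
  shows "(A + e * y) * ln (2 * y) \<le> c * y"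
proof -
  define q where "q = 6932 / 10000 * real j - 1"
  define s where "s = (2 / 2 ^ j :: real)"
  have "ln (2 * y) \<le> ln (2 ^ j) + 2 * y / 2 ^ j - 1"
    using assms by (intro ln_le_tangent) auto
  also have "ln (2 ^ j :: real) = j * ln 2" by (simp add: ln_realpow)
  also have "\<dots> \<le> real j * (6932 / 10000)"
    using ln_2_bounds by (intro mult_left_mono) auto
  finally have "ln (2 * y) \<le> q + s * y" by (simp add: q_def s_def mult_ac)
  then have "(A + e * y) * ln (2 * y) \<le> (A + e * y) * (q + s * y)"
    using assms by (intro mult_left_mono) auto
  also have "\<dots> = (e * s) * y\<^sup>2 + (A * s + e * q - c) * y + A * q + c * y"
    by (simp add: power2_eq_square algebra_simps)
  also have "(e * s) * y\<^sup>2 + (A * s + e * q - c) * y + A * q + c * y \<le> 0 + c * y"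
    by (intro add_right_mono, rule convex_quadratic_nonpos[OF _ assms(2,3)])
      (use assms in \<open>auto simp: q_def s_def power2_eq_square field_simps\<close>)
  finally show ?thesis by simp
qed

text \<open>The constant \<open>2131 / 1000\<close> is a rational just below
  \<open>2 * 1.538 * ln 2\<close>. Exponent 1/2 serves up to 14, 1/3 up to 110 and 1/4 beyond;
  \<open>j\<close> is chosen so that \<open>2 ^ j\<close> lies in or near the range of
  \<open>2 * y\<close>.\<close>

lemma ln_card_divisors_square_mult_ln_le_small:
  fixes m :: nat and y :: real
  assumes "m > 0" "ln m \<le> y" "69 / 100 \<le> y" "y \<le> 2048"
  shows "ln (card {d. d dvd m\<^sup>2}) * ln (2 * y) \<le> 2131 / 1000 * y"
proof -
  have ln0: "ln (2 * y) \<ge> 0" using assms by simp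
  have reduce: ?thesis if "ln (card {d. d dvd m\<^sup>2}) \<le> B * ln 2 + e * ln m"
    "(B * (6932 / 10000) + e * y) * ln (2 * y) \<le> 2131 / 1000 * y" "B \<ge> 0" "e \<ge> 0" for B e :: real
  proof -
    have "B * ln 2 \<le> B * (6932 / 10000)" "e * ln m \<le> e * y"
      using that ln_2_bounds assms by (auto simp only: intro!: mult_left_mono)
    then have "ln (card {d. d dvd m\<^sup>2}) \<le> B * (6932 / 10000) + e * y"
      using that by linarith
    then have "ln (card {d. d dvd m\<^sup>2}) * ln (2 * y) \<le> (B * (6932 / 10000) + e * y) * ln (2 * y)"
      using ln0 by (rule mult_right_mono)
    then show ?thesis using that by linarith
  qed
  consider "y \<le> 125 / 100" | "125 / 100 \<le> y" "y \<le> 275 / 100" | "275 / 100 \<le> y" "y \<le> 6"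
    | "6 \<le> y" "y \<le> 11" | "11 \<le> y" "y \<le> 14" | "14 \<le> y" "y \<le> 28" | "28 \<le> y" "y \<le> 110"
    | "110 \<le> y" "y \<le> 700" | "700 \<le> y" by linarith
  then show ?thesis
  proof cases
    case 1
    show ?thesis
      by (rule reduce[OF ln_card_divisors_square_le_root2 affine_mult_ln_le[where j = 1, OF _ assms(3) 1]])
        (use assms in auto)
  next
    case 2
    show ?thesis
      by (rule reduce[OF ln_card_divisors_square_le_root2 affine_mult_ln_le[where j = 2, OF _ 2]])
        (use assms in auto)
  next
    case 3
    show ?thesis
      by (rule reduce[OF ln_card_divisors_square_le_root2 affine_mult_ln_le[where j = 3, OF _ 3]])
        (use assms in auto)
  next
    case 4
    show ?thesis
      by (rule reduce[OF ln_card_divisors_square_le_root2 affine_mult_ln_le[where j = 4, OF _ 4]])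
        (use assms in auto)
  next
    case 5
    show ?thesis
      by (rule reduce[OF ln_card_divisors_square_le_root2 affine_mult_ln_le[where j = 5, OF _ 5]])
        (use assms in auto)
  next
    case 6
    show ?thesis
      by (rule reduce[OF ln_card_divisors_square_le_root3 affine_mult_ln_le[where j = 5, OF _ 6]])
        (use assms in auto)
  next
    case 7
    show ?thesis
      by (rule reduce[OF ln_card_divisors_square_le_root3 affine_mult_ln_le[where j = 7, OF _ 7]])
        (use assms in auto)
  next
    case 8
    show ?thesis
      by (rule reduce[OF ln_card_divisors_square_le_root4 affine_mult_ln_le[where j = 9, OF _ 8]])
        (use assms in auto)
  next
    case 9
    show ?thesis
      by (rule reduce[OF ln_card_divisors_square_le_root4 affine_mult_ln_le[where j = 12, OF _ 9 assms(4)]])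
        (use assms in auto)
  qed
qed

section \<open>An exponent depending on the size of \<open>ln m\<close>, for \<open>y\<close> from
  2048 on\<close>

lemma power_div_fact_le_exp:
  fixes x :: real
  assumes "x \<ge> 0"
  shows "x ^ N / fact N \<le> exp x"
proof -
  have "(\<Sum>n\<in>{N}. inverse (fact n) *\<^sub>R x ^ n) \<le> exp x"
    unfolding exp_def using assms by (intro sum_le_suminf summable_exp_generic) auto
  then show ?thesis by (simp add: field_simps)
qed

text \<open>With \<open>N\<close> the integer part of \<open>P\<close>, the sum is
  \<open>ln (P ^ N / fact N)\<close>, and \<open>P ^ N / fact N\<close> is a single term of the
  series of \<open>exp P\<close>.\<close>

lemma sum_ln_quotient_le:
  fixes P :: real
  assumes "P \<ge> 1"
  shows "(\<Sum>n\<in>{1..nat \<lfloor>P\<rfloor>}. ln (P / n)) \<le> P"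
proof -
  let ?N = "nat \<lfloor>P\<rfloor>"
  have "(\<Sum>n\<in>{1..?N}. ln (P / n)) = (\<Sum>n\<in>{1..?N}. ln P - ln n)"
    using assms by (intro sum.cong) (auto simp: ln_div)
  also have "\<dots> = ?N * ln P - ln (\<Prod>n\<in>{1..?N}. real n)"
    by (subst ln_prod) (auto simp: sum_subtractf)
  also have "(\<Prod>n\<in>{1..?N}. real n) = fact ?N"
    by (simp add: fact_prod)
  also have "?N * ln P - ln (fact ?N) = ln (P ^ ?N / fact ?N)"
    using assms by (simp add: ln_div ln_realpow)
  also have "\<dots> \<le> ln (exp P)"
    using power_div_fact_le_exp[of P ?N] assms by (subst ln_le_cancel_iff) auto
  finally show ?thesis by simp
qed

text \<open>The choice of \<open>\<epsilon>\<close> makes \<open>P powr \<epsilon> = 3\<close>, so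
  primes above \<open>P\<close> need no correction. Those from \<open>sqrt P\<close> to
  \<open>P\<close> cost \<open>\<epsilon> * ln (P / p)\<close> each, at most
  \<open>\<epsilon> * P\<close> in total. Below \<open>sqrt P\<close> the crude cost
  \<open>ln (8 / 3 * ln P)\<close> is paid at most \<open>sqrt P\<close> times.\<close>

lemma ln_card_divisors_square_le_general:
  fixes m :: nat and P :: real
  assumes "m > 0" "P \<ge> 9"
  shows "ln (card {d. d dvd m\<^sup>2}) \<le> (ln m + P) * (ln 3 / ln P) + sqrt P * ln (8 / 3 * ln P)"
proof -
  define \<epsilon> where "\<epsilon> = ln 3 / ln P"
  let ?N = "nat \<lfloor>P\<rfloor>"
  define b where "b = (\<lambda>p::nat. if p < sqrt P then ln (8 / 3 * ln P) else \<epsilon> * ln (P / p))"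
  have "ln 3 \<le> ln P" using assms by (subst ln_le_cancel_iff) auto
  then have lnP: "ln P > 0" "8 / 3 * ln P \<ge> 1" using ln_3_bounds by auto
  have eP: "\<epsilon> * ln P = ln 3" using lnP by (simp add: \<epsilon>_def)
  have e0: "\<epsilon> > 0" using lnP by (simp add: \<epsilon>_def)
  have N: "n \<in> {1..?N} \<longleftrightarrow> 0 < n \<and> real n \<le> P" for n
    using assms by (auto simp: le_nat_floor Suc_le_eq) linarith
  have logs: "ln (2 * real a + 1) \<le> ln c + real a * u"
    if "(2 * real a + 1) ^ 1 \<le> c * exp u ^ a" "c > 0" for a c u
  proof -
    have "ln (2 * real a + 1) \<le> ln (c * exp u ^ a)"
      using that by (subst ln_le_cancel_iff) auto
    also have "\<dots> = ln c + a * u" using that by (simp add: ln_mult ln_realpow)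
    finally show ?thesis .
  qed
  have "ln (card {d. d dvd m\<^sup>2}) \<le> (\<Sum>p\<in>{1..?N}. b p) + \<epsilon> * ln m"
  proof (rule ln_card_divisors_square_le[OF assms(1)])
    fix p a :: nat assume p: "prime p" "p \<in> {1..?N}"
    have p2: "real p \<ge> 2" using prime_ge_2_nat[OF p(1)] by simp
    have pP: "real p \<le> P" using p(2) N by simp
    define u where "u = \<epsilon> * ln p"
    have "ln 2 \<le> ln p" using p2 by (subst ln_le_cancel_iff) auto
    then have lnp: "69 / 100 \<le> ln p" using ln_2_bounds by linarith
    then have u0: "u > 0" using e0 by (simp add: u_def)
    have "ln p \<le> ln P" using p2 pP by (subst ln_le_cancel_iff) auto
    then have "u \<le> \<epsilon> * ln P" unfolding u_def using e0 by (intro mult_left_mono) auto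
    then have u3: "u \<le> ln 3" using eP by simp
    have "ln (2 * real a + 1) \<le> b p + real a * u"
    proof (cases "p < sqrt P")
      case True
      \<comment> \<open>From \<open>u <= 2\<close> follows
        \<open>2 * a + 1 <= 2 / u * (1 + a * u)\<close>, where
        \<open>1 + a * u <= exp (a * u)\<close>. The factor \<open>2 / u\<close> is at most
        \<open>8 / 3 * ln P\<close> because \<open>u * ln P = ln 3 * ln p >= 3 / 4\<close>.\<close>
      have u2: "u \<le> 2" using u3 ln_3_bounds by simp
      have "109 / 100 * (69 / 100) \<le> ln 3 * ln p"
        using lnp ln_3_bounds by (intro mult_mono) auto
      also have "ln 3 * ln p = u * ln P" unfolding u_def eP[symmetric] by simp
      finally have "2 \<le> 8 / 3 * ln P * u" by simp
      then have "2 * (1 + a * u) \<le> 8 / 3 * ln P * u * (1 + a * u)"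
        using u0 by (intro mult_right_mono) auto
      moreover have "(2 * real a + 1) * u \<le> 2 * (1 + a * u)"
        using u2 by (simp add: algebra_simps)
      ultimately have "(2 * real a + 1) * u \<le> 8 / 3 * ln P * u * (1 + a * u)"
        by (rule order_trans[rotated])
      also have "\<dots> = (8 / 3 * ln P * (1 + a * u)) * u" by (simp only: mult_ac)
      finally have "(2 * real a + 1) * u \<le> (8 / 3 * ln P * (1 + a * u)) * u" .
      then have "2 * real a + 1 \<le> 8 / 3 * ln P * (1 + a * u)"
        using u0 by (simp only: mult_le_cancel_right)
      also have "\<dots> \<le> 8 / 3 * ln P * exp (a * u)"
        using lnP by (intro mult_left_mono) auto
      finally have "(2 * real a + 1) ^ 1 \<le> 8 / 3 * ln P * exp u ^ a"
        by (simp add: exp_of_nat_mult)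
      from logs[OF this] show ?thesis using True lnP by (simp add: b_def)
    next
      case False
      \<comment> \<open>Now \<open>exp u = p powr \<epsilon>\<close> is at least
        \<open>sqrt 3 > 5 / 3\<close>, so the worst case is \<open>a = 1\<close>, with constant
        \<open>3 / exp u = (P / p) powr \<epsilon>\<close>.\<close>
      then have "P \<le> p\<^sup>2" using assms real_sqrt_le_iff[of P "p\<^sup>2"] by (simp add: real_le_lsqrt)
      then have "ln P \<le> ln (p\<^sup>2)" using assms p2 by (subst ln_le_cancel_iff) auto
      also have "\<dots> = 2 * ln p" using p2 by (simp add: ln_realpow)
      finally have "\<epsilon> * ln P \<le> \<epsilon> * (2 * ln p)"
        using e0 by (intro mult_left_mono) auto
      then have "ln 3 \<le> 2 * u" using eP by (simp add: u_def)
      moreover have "2 * ln (5 / 3) \<le> ln (3::real)"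
      proof -
        have "2 * ln (5 / 3 :: real) = ln ((5 / 3)\<^sup>2)" by (simp add: ln_realpow)
        also have "\<dots> \<le> ln 3" by (subst ln_le_cancel_iff) (auto simp: power_divide)
        finally show ?thesis .
      qed
      ultimately have "ln (5 / 3) \<le> u" by linarith
      then have u53: "5 / 3 \<le> exp u" using exp_le_cancel_iff[of "ln (5 / 3)" u] by simp
      have "exp u \<le> exp (ln 3)" using u3 by (simp only: exp_le_cancel_iff)
      then have "exp u \<le> 3" by simp
      then have "(2 * real a + 1) ^ 1 \<le> 3 ^ 1 / exp u * exp u ^ a"
        using u53 by (intro odd_power_le_one) auto
      then have "(2 * real a + 1) ^ 1 \<le> 3 / exp u * exp u ^ a" by simp
      from logs[OF this] have "ln (2 * real a + 1) \<le> ln 3 - u + a * u"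
        by (simp add: ln_div)
      also have "ln 3 - u = \<epsilon> * ln (P / p)"
        using eP p2 assms by (simp add: u_def ln_div right_diff_distrib)
      finally show ?thesis using False by (simp add: b_def)
    qed
    then show "ln (2 * real a + 1) \<le> b p + real a * (\<epsilon> * ln p)" by (simp add: u_def)
  next
    fix p a :: nat assume p: "prime p" "p \<notin> {1..?N}"
    then have pP: "P < p" using N[of p] prime_gt_0_nat[of p] by auto
    then have "ln P \<le> ln p" using assms by (subst ln_le_cancel_iff) auto
    then have "\<epsilon> * ln P \<le> \<epsilon> * ln p" using e0 by (intro mult_left_mono) auto
    then have "exp (ln 3) \<le> exp (\<epsilon> * ln p)" unfolding eP by (simp only: exp_le_cancel_iff)
    then have three: "3 \<le> exp (\<epsilon> * ln p)" by simp
    have "(2 * real a + 1) ^ 1 \<le> 1 * exp (\<epsilon> * ln p) ^ a"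
      by (rule odd_power_le[where ?a0.0 = 0]) (use three in auto)
    from logs[OF this] show "ln (2 * real a + 1) \<le> real a * (\<epsilon> * ln p)" by simp
  next
    fix p assume "p \<in> {1..?N}"
    then have "P / p \<ge> 1" using N[of p] by simp
    then show "b p \<ge> 0" using e0 lnP by (auto simp: b_def)
  qed auto
  \<comment> \<open>Adding the nonnegative term \<open>\<epsilon> * ln (P / p)\<close> for small
    \<open>p\<close> as well completes the sum over all integers up to \<open>P\<close>.\<close>
  also have "(\<Sum>p\<in>{1..?N}. b p) \<le>
      (\<Sum>p\<in>{1..?N}. (if p < sqrt P then ln (8 / 3 * ln P) else 0) + \<epsilon> * ln (P / p))"
  proof (rule sum_mono)
    fix p assume "p \<in> {1..?N}"
    then have "P / p \<ge> 1" using N[of p] by simp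
    then show "b p \<le> (if p < sqrt P then ln (8 / 3 * ln P) else 0) + \<epsilon> * ln (P / p)"
      using e0 by (auto simp: b_def)
  qed
  also have "\<dots> = (\<Sum>p\<in>{1..?N}. if p < sqrt P then ln (8 / 3 * ln P) else 0)
      + \<epsilon> * (\<Sum>p\<in>{1..?N}. ln (P / p))"
    by (simp only: sum.distrib sum_distrib_left)
  also have "(\<Sum>p\<in>{1..?N}. if p < sqrt P then ln (8 / 3 * ln P) else 0)
      = card {p\<in>{1..?N}. p < sqrt P} * ln (8 / 3 * ln P)"
    by (simp add: sum.inter_filter[symmetric])
  also have "\<dots> \<le> sqrt P * ln (8 / 3 * ln P)"
  proof (rule mult_right_mono)
    have "{p\<in>{1..?N}. p < sqrt P} \<subseteq> {1..nat \<lfloor>sqrt P\<rfloor>}"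
      by (auto simp: le_nat_floor)
    then have "card {p\<in>{1..?N}. p < sqrt P} \<le> card {1..nat \<lfloor>sqrt P\<rfloor>}"
      by (rule card_mono[rotated]) simp
    then have "real (card {p\<in>{1..?N}. p < sqrt P}) \<le> real (nat \<lfloor>sqrt P\<rfloor>)"
      by simp
    also have "\<dots> \<le> sqrt P" using assms by (simp add: of_nat_floor)
    finally show "real (card {p\<in>{1..?N}. p < sqrt P}) \<le> sqrt P" .
  qed (use lnP in simp)
  also have "\<epsilon> * (\<Sum>p\<in>{1..?N}. ln (P / p)) \<le> \<epsilon> * P"
    using sum_ln_quotient_le[of P] assms e0 by (intro mult_left_mono) auto
  finally show ?thesis unfolding \<epsilon>_def[symmetric] by (simp add: algebra_simps)
qed

text \<open>With \<open>P = y / 8\<close> one has \<open>ln P = t - 4 * ln 2\<close>. The budget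
  \<open>2131 / 1000\<close> is split into \<open>186 / 100\<close> for the term with
  \<open>ln 3 / ln P\<close> and \<open>271 / 1000\<close> for the term with
  \<open>sqrt P\<close>.\<close>

lemma ln_card_divisors_square_mult_ln_le_large:
  fixes m :: nat and y :: real
  assumes "m > 0" "ln m \<le> y" "2048 \<le> y"
  shows "ln (card {d. d dvd m\<^sup>2}) * ln (2 * y) \<le> 2131 / 1000 * y"
proof -
  define t where "t = ln (2 * y)"
  \<comment> \<open>The fourth root turns \<open>sqrt P\<close> into \<open>w\<^sup>2 / 4\<close>,
    and the tangent of \<open>ln\<close> at 8 bounds \<open>t = 4 * ln w\<close> linearly in
    \<open>w\<close>; \<open>w >= 8\<close> since \<open>2 * y >= 8 ^ 4\<close>.\<close>
  define w where "w = sqrt (sqrt (2 * y))"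
  have ln_power: "ln (2 ^ 12 :: real) = 12 * ln 2" "ln (2 ^ 3 :: real) = 3 * ln 2"
    "ln (2 ^ 4 :: real) = 4 * ln 2"
    by (simp_all only: ln_realpow zero_less_numeral of_nat_numeral)
  have "ln (2 ^ 12) \<le> t" unfolding t_def using assms by (subst ln_le_cancel_iff) auto
  then have t: "8317 / 1000 \<le> t" using ln_2_bounds unfolding ln_power by linarith
  have "w ^ 4 = (w\<^sup>2)\<^sup>2" by simp
  also have "\<dots> = 2 * y" using assms by (simp add: w_def)
  finally have w4: "w ^ 4 = 2 * y" .
  have w8: "w \<ge> 8"
    unfolding w_def using assms by (intro real_le_rsqrt) auto
  have "t = 4 * ln w" unfolding t_def w4[symmetric] using w8 by (simp add: ln_realpow)
  moreover have "ln w \<le> ln (2 ^ 3) + w / 2 ^ 3 - 1"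
    using w8 by (intro ln_le_tangent) auto
  ultimately have tw: "t \<le> 432 / 100 + w / 2"
    using ln_2_bounds unfolding ln_power by simp
  define P where "P = y / 8"
  have P: "P = 2 * y / 2 ^ 4" by (simp add: P_def)
  have "ln P = t - 4 * ln 2"
    unfolding P t_def ln_power(3)[symmetric] using assms by (subst ln_div) auto
  then have lnP: "t - 2773 / 1000 \<le> ln P" "ln P \<le> t - 2772 / 1000" using ln_2_bounds by auto
  have "ln (card {d. d dvd m\<^sup>2}) \<le> (ln m + P) * (ln 3 / ln P) + sqrt P * ln (8 / 3 * ln P)"
    using assms by (intro ln_card_divisors_square_le_general) (auto simp: P_def)
  also have "(ln m + P) * (ln 3 / ln P) \<le> (9 / 8 * y) * (1099 / 1000 / (t - 2773 / 1000))"
    using assms ln_3_bounds lnP t by (intro mult_mono frac_le) (auto simp: P_def)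
  also have "ln (8 / 3 * ln P) \<le> t / 3 + 16 / 100"
  proof -
    have "ln (8 / 3 * ln P) \<le> ln (2 ^ 3) + (8 / 3 * ln P) / 2 ^ 3 - 1"
      using lnP t by (intro ln_le_tangent) auto
    then show ?thesis using lnP ln_2_bounds unfolding ln_power by simp
  qed
  then have "sqrt P * ln (8 / 3 * ln P) \<le> sqrt P * (t / 3 + 16 / 100)"
    using assms by (intro mult_left_mono) (auto simp: P_def)
  finally have main: "ln (card {d. d dvd m\<^sup>2})
    \<le> (9 / 8 * y) * (1099 / 1000 / (t - 2773 / 1000)) + sqrt P * (t / 3 + 16 / 100)" by simp
  have sqrtP: "sqrt P = w\<^sup>2 / 4"
  proof (rule real_sqrt_unique)
    show "(w\<^sup>2 / 4)\<^sup>2 = P" using w4 by (simp add: P_def power_divide)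
  qed simp
  have "(9 / 8 * y) * (1099 / 1000 / (t - 2773 / 1000)) * t \<le> 186 / 100 * y"
  proof -
    \<comment> \<open>The quotient \<open>t / (t - 2773 / 1000)\<close> decreases in
      \<open>t\<close>, so the lower bound on \<open>t\<close> decides.\<close>
    have "9 / 8 * (1099 / 1000) * t \<le> 186 / 100 * (t - 2773 / 1000)" using t by simp
    then have "9 / 8 * (1099 / 1000) * t / (t - 2773 / 1000) \<le> 186 / 100"
      using t by (subst pos_divide_le_eq) auto
    then have "y * (9 / 8 * (1099 / 1000) * t / (t - 2773 / 1000)) \<le> y * (186 / 100)"
      using assms by (intro mult_left_mono) auto
    then show ?thesis by (simp add: mult_ac)
  qed
  moreover have "sqrt P * (t / 3 + 16 / 100) * t \<le> 271 / 1000 * y"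
  proof -
    have t': "t \<le> 104 / 100 * w" using tw w8 by simp
    then have "t * t \<le> (104 / 100 * w) * (104 / 100 * w)" using t by (intro mult_mono) auto
    moreover have "w * 8 \<le> w * w" using w8 by (intro mult_left_mono) auto
    moreover have "(104 / 100 * w) * (104 / 100 * w) = 10816 / 10000 * (w * w)"
      "(t / 3 + 16 / 100) * t = t * t / 3 + 16 / 100 * t" by (simp_all add: algebra_simps)
    ultimately have "(t / 3 + 16 / 100) * t \<le> 542 / 1000 * w\<^sup>2"
      using t' w8 unfolding power2_eq_square by linarith
    then have "w\<^sup>2 / 4 * ((t / 3 + 16 / 100) * t) \<le> w\<^sup>2 / 4 * (542 / 1000 * w\<^sup>2)"
      by (intro mult_left_mono) auto
    also have "\<dots> = 271 / 1000 * (w ^ 4 / 2)" by (simp add: power2_eq_square power4_eq_xxxx)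
    finally show ?thesis unfolding sqrtP w4 by (simp add: mult_ac)
  qed
  moreover have "ln (card {d. d dvd m\<^sup>2}) * t
    \<le> ((9 / 8 * y) * (1099 / 1000 / (t - 2773 / 1000)) + sqrt P * (t / 3 + 16 / 100)) * t"
    using main t by (intro mult_right_mono) auto
  ultimately have "ln (card {d. d dvd m\<^sup>2}) * t \<le> 186 / 100 * y + 271 / 1000 * y"
    unfolding distrib_right by linarith
  then show ?thesis by (simp add: t_def)
qed

text \<open>An upper bound \<open>y\<close> replaces \<open>ln m\<close> because one estimate must
  serve every possible edge count of the final two-vertex graph.\<close>

lemma ln_card_divisors_square_mult_ln_le:
  fixes m :: nat and y :: real
  assumes "m > 0" "ln m \<le> y" "ln 2 \<le> y"
  shows "ln (card {d. d dvd m\<^sup>2}) * ln (2 * y) \<le> 2 * 1.538 * ln 2 * y"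
proof -
  have y: "69 / 100 \<le> y" using assms(3) ln_2_bounds by linarith
  have "ln (card {d. d dvd m\<^sup>2}) * ln (2 * y) \<le> 2131 / 1000 * y"
    using ln_card_divisors_square_mult_ln_le_small[OF assms(1,2) y]
      ln_card_divisors_square_mult_ln_le_large[OF assms(1,2)] by linarith
  also have "\<dots> \<le> (2 * 1.538 * ln 2) * y"
    using ln_2_bounds y by (intro mult_right_mono) auto
  finally show ?thesis .
qed

section \<open>Elimination of a vertex\<close>

text \<open>Only \<open>r\<close> is kept, with \<open>d\<close> hidden in the divisibility. Weights
  replace individual edges so that eliminating a vertex stays within the notion.\<close>

definition weight_structures :: "'v set \<Rightarrow> ('v \<Rightarrow> 'v \<Rightarrow> nat) \<Rightarrow> ('v \<Rightarrow> nat) set" where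
  "weight_structures V w = {r \<in> V \<rightarrow>\<^sub>E {0<..}. Gcd (r ` V) = 1 \<and>
     (\<forall>v\<in>V. r v dvd (\<Sum>u\<in>V - {v}. r u * w v u))}"

text \<open>In contrast to paths, cuts behave well under the elimination of a vertex.\<close>
definition cut_connected :: "'v set \<Rightarrow> ('v \<Rightarrow> 'v \<Rightarrow> nat) \<Rightarrow> bool" where
  "cut_connected V w \<longleftrightarrow>
     (\<forall>S. S \<subseteq> V \<longrightarrow> S \<noteq> {} \<longrightarrow> S \<noteq> V \<longrightarrow> (\<exists>u\<in>S. \<exists>v\<in>V - S. w u v > 0))"

text \<open>Off the diagonal this is a Schur complement scaled by \<open>d\<close>: the equation at
  \<open>x\<close> is substituted into \<open>d\<close> times the other equations. The diagonal can
  be set to 0 because it contributes only multiples of \<open>r v\<close> to the sum at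
  \<open>v\<close>.\<close>

definition eliminate :: "('v \<Rightarrow> 'v \<Rightarrow> nat) \<Rightarrow> 'v \<Rightarrow> nat \<Rightarrow> 'v \<Rightarrow> 'v \<Rightarrow> nat" where
  "eliminate w x d u v = (if u = v then 0 else d * w u v + w u x * w x v)"

lemma cut_connectedD:
  assumes "cut_connected V w" "S \<subseteq> V" "S \<noteq> {}" "S \<noteq> V"
  shows "\<exists>u\<in>S. \<exists>v\<in>V - S. w u v > 0"
  using assms unfolding cut_connected_def by blast

lemma cut_connected_neighbour:
  assumes "cut_connected V w" "x \<in> V" "V \<noteq> {x}"
  obtains v where "v \<in> V - {x}" "w x v > 0"
  using cut_connectedD[OF assms(1), of "{x}"] assms(2,3) by auto

text \<open>If no old edge joins \<open>S\<close> to the rest, the cuts \<open>S\<close> and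
  \<open>insert x S\<close> of the old graph show that both sides are adjacent to \<open>x\<close>,
  so the product term is positive.\<close>

lemma cut_connected_eliminate:
  assumes conn: "cut_connected V w" and "x \<in> V" "d > 0"
  shows "cut_connected (V - {x}) (eliminate w x d)"
  unfolding cut_connected_def
proof (intro allI impI)
  fix S assume S: "S \<subseteq> V - {x}" "S \<noteq> {}" "S \<noteq> V - {x}"
  have "S \<subseteq> V" "S \<noteq> V" "insert x S \<subseteq> V" "insert x S \<noteq> V"
    using S \<open>x \<in> V\<close> by auto
  then have cut: "\<exists>u\<in>S. \<exists>v\<in>V - S. w u v > 0"
    "\<exists>u\<in>insert x S. \<exists>v\<in>V - insert x S. w u v > 0"
    using S(2) by (intro cut_connectedD[OF conn]; simp)+
  show "\<exists>u\<in>S. \<exists>v\<in>V - {x} - S. eliminate w x d u v > 0"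
  proof (cases "\<exists>u\<in>S. \<exists>v\<in>V - {x} - S. w u v > 0")
    case True
    then obtain u v where "u \<in> S" "v \<in> V - {x} - S" "w u v > 0" by blast
    moreover from this have "eliminate w x d u v > 0"
      using \<open>d > 0\<close> by (auto simp: eliminate_def)
    ultimately show ?thesis by blast
  next
    case False
    then obtain u where u: "u \<in> S" "w u x > 0" using cut(1) by blast
    moreover obtain v where v: "v \<in> V - {x} - S" "w x v > 0" using cut(2) False by blast
    ultimately have "eliminate w x d u v > 0" by (auto simp: eliminate_def)
    then show ?thesis using u v by blast
  qed
qed

text \<open>All sums count edges twice. With \<open>D\<close> the degree of \<open>x\<close> and
  \<open>S\<close> the remaining total, \<open>S + 2 * D <= 2 * m\<close>, while the new total is at
  most \<open>D * S + D * D <= D * (S + 2 * D)\<close>.\<close>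

lemma sum_eliminate_le:
  fixes w :: "'v \<Rightarrow> 'v \<Rightarrow> nat"
  assumes "finite V" "x \<in> V" and sym: "\<And>u v. w u v = w v u" and diag: "w x x = 0"
    and total: "(\<Sum>u\<in>V. \<Sum>v\<in>V. w u v) \<le> 2 * m" and d: "d \<le> (\<Sum>u\<in>V - {x}. w x u)"
  shows "(\<Sum>u\<in>V - {x}. \<Sum>v\<in>V - {x}. eliminate w x d u v) \<le> 2 * m\<^sup>2"
    and "(\<Sum>u\<in>V - {x}. w x u) \<le> m"
proof -
  let ?U = "V - {x}"
  let ?D = "\<Sum>u\<in>?U. w x u" and ?S = "\<Sum>u\<in>?U. \<Sum>v\<in>?U. w u v"
  have split: "sum f V = f x + sum f ?U" for f :: "'v \<Rightarrow> nat"
    using assms(1,2) by (rule sum.remove)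
  have "(\<Sum>u\<in>V. \<Sum>v\<in>V. w u v) = ?D + ((\<Sum>u\<in>?U. w u x) + ?S)"
    by (simp add: split diag sum.distrib)
  also have "(\<Sum>u\<in>?U. w u x) = ?D" by (rule sum.cong) (auto intro: sym)
  finally have S: "?S + 2 * ?D \<le> 2 * m" using total by simp
  then show D: "?D \<le> m" by simp
  have "(\<Sum>u\<in>?U. \<Sum>v\<in>?U. eliminate w x d u v) \<le> (\<Sum>u\<in>?U. \<Sum>v\<in>?U. d * w u v + w x u * w x v)"
    by (intro sum_mono) (auto simp: eliminate_def sym[of _ x])
  also have "\<dots> = d * ?S + ?D * ?D"
    unfolding sum_product by (simp add: sum.distrib sum_distrib_left)
  also have "\<dots> \<le> ?D * ?S + ?D * ?D" using d by (simp add: mult_right_mono)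
  also have "\<dots> \<le> ?D * (?S + 2 * ?D)" by (simp add: algebra_simps)
  also have "\<dots> \<le> m * (2 * m)" using S D by (intro mult_mono) auto
  finally show "(\<Sum>u\<in>?U. \<Sum>v\<in>?U. eliminate w x d u v) \<le> 2 * m\<^sup>2"
    by (simp add: power2_eq_square mult_ac)
qed

text \<open>Multiply the sum at \<open>v\<close> by \<open>d\<close> and replace
  \<open>r x * d\<close> by the sum at \<open>x\<close>. The term with \<open>u = v\<close> is a
  multiple of \<open>r v\<close> and drops out.\<close>

lemma eliminate_dvd:
  fixes r :: "'v \<Rightarrow> nat"
  assumes "finite V" "x \<in> V" "v \<in> V - {x}" and sym: "\<And>u v. w u v = w v u"
    and dvd: "r v dvd (\<Sum>u\<in>V - {v}. r u * w v u)"
    and d: "r x * d = (\<Sum>u\<in>V - {x}. r u * w x u)"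
  shows "r v dvd (\<Sum>u\<in>V - {x} - {v}. r u * eliminate w x d v u)"
proof -
  let ?W = "V - {x} - {v}"
  have "(\<Sum>u\<in>V - {v}. r u * w v u) = r x * w v x + (\<Sum>u\<in>V - {v} - {x}. r u * w v u)"
    using assms by (intro sum.remove) auto
  also have "V - {v} - {x} = ?W" by auto
  finally have v: "(\<Sum>u\<in>V - {v}. r u * w v u) = r x * w v x + (\<Sum>u\<in>?W. r u * w v u)" .
  have x: "(\<Sum>u\<in>V - {x}. r u * w x u) = r v * w x v + (\<Sum>u\<in>?W. r u * w x u)"
    using assms by (intro sum.remove) auto
  have "d * (\<Sum>u\<in>V - {v}. r u * w v u)
      = w v x * (r x * d) + d * (\<Sum>u\<in>?W. r u * w v u)"
    unfolding v by (simp add: algebra_simps)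
  also have "\<dots> = r v * (w v x * w x v) + (\<Sum>u\<in>?W. r u * (d * w v u + w v x * w x u))"
    unfolding d x by (simp add: algebra_simps sum.distrib sum_distrib_left)
  also have "(\<Sum>u\<in>?W. r u * (d * w v u + w v x * w x u)) = (\<Sum>u\<in>?W. r u * eliminate w x d v u)"
    by (rule sum.cong) (auto simp: eliminate_def)
  finally have "r v dvd r v * (w v x * w x v) + (\<Sum>u\<in>?W. r u * eliminate w x d v u)"
    using dvd by (metis dvd_mult)
  then show ?thesis by (metis dvd_add_right_iff dvd_triv_left)
qed

lemma Gcd_image_mult_nat:
  fixes s :: "'v \<Rightarrow> nat"
  shows "Gcd ((\<lambda>u. g * s u) ` U) = g * Gcd (s ` U)"
  using Gcd_mult[of g "s ` U"] by (simp add: image_image)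

text \<open>Restricting to \<open>V - {x}\<close> and dividing by the gcd is injective on
  \<open>B\<close>. Equal images mean proportional restrictions, the equation at \<open>x\<close>
  with the common \<open>d\<close> extends the proportion to \<open>x\<close>, and gcd 1 on both
  sides makes the factor 1.\<close>

lemma card_structures_le_eliminate:
  fixes w :: "'v \<Rightarrow> 'v \<Rightarrow> nat"
  assumes "finite V" "x \<in> V" "V \<noteq> {x}" "d > 0" and sym: "\<And>u v. w u v = w v u"
    and fin: "finite (weight_structures (V - {x}) (eliminate w x d))"
  defines "B \<equiv> {r \<in> weight_structures V w. r x * d = (\<Sum>u\<in>V - {x}. r u * w x u)}"
  shows "finite B \<and> card B \<le> card (weight_structures (V - {x}) (eliminate w x d))"
proof -
  let ?U = "V - {x}"
  define g where "g r = Gcd (r ` ?U)" for r :: "'v \<Rightarrow> nat"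
  define \<phi> where "\<phi> r = restrict (\<lambda>u. r u div g r) ?U" for r :: "'v \<Rightarrow> nat"
  have U: "?U \<noteq> {}" using assms(2,3) by blast
  have rpos: "r u > 0" if "r \<in> B" "u \<in> V" for r u
    using that by (auto simp: B_def weight_structures_def)
  have gr: "r u = g r * \<phi> r u" if "u \<in> ?U" for r u
    using that by (simp add: \<phi>_def g_def)
  have gpos: "g r > 0" if "r \<in> B" for r
  proof -
    obtain u where u: "u \<in> ?U" using U by blast
    then show ?thesis using gr[OF u, of r] rpos[OF that, of u] by (cases "g r = 0") auto
  qed
  have "\<phi> r \<in> weight_structures ?U (eliminate w x d)" if r: "r \<in> B" for r
  proof -
    have "\<phi> r \<in> ?U \<rightarrow>\<^sub>E {0<..}"
    proof (rule PiE_I)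
      fix u assume "u \<in> ?U"
      then show "\<phi> r u \<in> {0<..}" using gr[of u r] rpos[OF r, of u] by (cases "\<phi> r u = 0") auto
    qed (auto simp: \<phi>_def)
    moreover have "Gcd (\<phi> r ` ?U) = 1"
    proof -
      have "g r = Gcd ((\<lambda>u. g r * \<phi> r u) ` ?U)"
        unfolding g_def[of r] using gr[of _ r] by (metis (no_types, lifting) g_def image_cong)
      also have "\<dots> = g r * Gcd (\<phi> r ` ?U)" by (rule Gcd_image_mult_nat)
      finally show ?thesis using gpos[OF r] by simp
    qed
    moreover have "\<phi> r v dvd (\<Sum>u\<in>?U - {v}. \<phi> r u * eliminate w x d v u)" if v: "v \<in> ?U" for v
    proof -
      have "r v dvd (\<Sum>u\<in>?U - {v}. r u * eliminate w x d v u)"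
        using r v assms(1,2) by (intro eliminate_dvd sym) (auto simp: B_def weight_structures_def)
      also have "(\<Sum>u\<in>?U - {v}. r u * eliminate w x d v u)
          = (\<Sum>u\<in>?U - {v}. g r * (\<phi> r u * eliminate w x d v u))"
        using gr by (intro sum.cong) auto
      finally have "g r * \<phi> r v dvd g r * (\<Sum>u\<in>?U - {v}. \<phi> r u * eliminate w x d v u)"
        using gr[OF v] by (simp add: sum_distrib_left)
      then show ?thesis using gpos[OF r] by simp
    qed
    ultimately show ?thesis by (simp add: weight_structures_def)
  qed
  then have img: "\<phi> ` B \<subseteq> weight_structures ?U (eliminate w x d)" by blast
  have inj: "inj_on \<phi> B"
  proof (rule inj_onI)
    fix r s assume rs: "r \<in> B" "s \<in> B" "\<phi> r = \<phi> s"
    have onU: "g s * r u = g r * s u" if "u \<in> ?U" for u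
      using gr[OF that, of r] gr[OF that, of s] rs(3) by (simp add: mult_ac)
    have "d * (g s * r x) = g s * (r x * d)" by simp
    also have "\<dots> = (\<Sum>u\<in>?U. (g s * r u) * w x u)"
      using rs(1) by (simp add: B_def sum_distrib_left mult.assoc)
    also have "\<dots> = (\<Sum>u\<in>?U. (g r * s u) * w x u)"
      using onU by (intro sum.cong) auto
    also have "\<dots> = g r * (s x * d)"
      using rs(2) by (simp add: B_def sum_distrib_left mult.assoc)
    also have "\<dots> = d * (g r * s x)" by simp
    finally have "g s * r x = g r * s x" using \<open>d > 0\<close> by simp
    then have onV: "g s * r u = g r * s u" if "u \<in> V" for u
      using onU that by blast
    have one: "Gcd (r ` V) = 1" "Gcd (s ` V) = 1"
      using rs by (auto simp: B_def weight_structures_def)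
    have "g s * Gcd (r ` V) = g r * Gcd (s ` V)"
      unfolding Gcd_image_mult_nat[symmetric] using onV by (metis (no_types, lifting) image_cong)
    then have "g s = g r" using one by simp
    then have "r u = s u" if "u \<in> V" for u using onV[OF that] gpos[OF rs(1)] by simp
    then show "r = s"
      using rs by (intro extensionalityI[of _ V]) (auto simp: B_def weight_structures_def PiE_def)
  qed
  show ?thesis
    using inj_on_finite[OF inj img fin] card_inj_on_le[OF inj img fin] by blast
qed

text \<open>Both entries divide \<open>w a b\<close> and are coprime. The map
  \<open>r a * (w a b div r b)\<close> is \<open>w a b\<close> times the reduced fraction
  \<open>r a / r b\<close>, which determines both entries.\<close>

lemma card_structures_two_vertices:
  fixes w :: "'v \<Rightarrow> 'v \<Rightarrow> nat"
  assumes "a \<noteq> b" and sym: "\<And>u v. w u v = w v u" and j: "w a b > 0"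
  shows "finite (weight_structures {a, b} w) \<and>
    card (weight_structures {a, b} w) \<le> card {e. e dvd (w a b)\<^sup>2}"
proof -
  let ?A = "weight_structures {a, b} w" and ?j = "w a b"
  let ?f = "\<lambda>r::'v \<Rightarrow> nat. r a * (?j div r b)"
  have str: "r a > 0 \<and> r b > 0 \<and> coprime (r a) (r b) \<and> r a dvd ?j \<and> r b dvd ?j" if "r \<in> ?A" for r
  proof -
    have "{a, b} - {a} = {b}" "{a, b} - {b} = {a}" using assms(1) by auto
    then have "r a dvd r b * ?j" "r b dvd r a * ?j" and cop: "coprime (r a) (r b)"
      and pos: "r a > 0" "r b > 0"
      using that sym[of b a] by (auto simp: weight_structures_def coprime_iff_gcd_eq_1)
    then show ?thesis
      by (metis coprime_commute coprime_dvd_mult_right_iff)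
  qed
  have inj: "inj_on ?f ?A"
  proof (rule inj_onI)
    fix r s assume rs: "r \<in> ?A" "s \<in> ?A" "?f r = ?f s"
    note r = str[OF rs(1)] and s = str[OF rs(2)]
    obtain q q' where q: "?j = r b * q" "?j = s b * q'" using r s by (meson dvdE)
    then have "r a * q = s a * q'" using rs(3) r s by (metis nonzero_mult_div_cancel_left not_gr_zero)
    then have "?j * (r a * s b) = ?j * (s a * r b)"
      using q by (metis mult.assoc mult.commute mult.left_commute)
    then have "r a * s b = s a * r b" using j by simp
    then have "r a = s a" "r b = s b"
      using coprime_crossproduct_nat[of "r a" "r b" "s a" "s b"] r s by auto
    then show "r = s"
      using rs by (intro extensionalityI[of _ "{a, b}"]) (auto simp: weight_structures_def PiE_def)
  qed
  have img: "?f ` ?A \<subseteq> {e. e dvd ?j\<^sup>2}"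
  proof
    fix e assume "e \<in> ?f ` ?A"
    then obtain r where r: "r \<in> ?A" "e = ?f r" by blast
    then show "e \<in> {e. e dvd ?j\<^sup>2}"
      using str[OF r(1)] by (auto simp: power2_eq_square intro!: mult_dvd_mono)
  qed
  have fin: "finite {e. e dvd ?j\<^sup>2}" using j by simp
  show ?thesis
    using inj_on_finite[OF inj img fin] card_inj_on_le[OF inj img fin] by blast
qed

section \<open>Induction on the number of vertices\<close>

text \<open>At a vertex where \<open>r\<close> is maximal every \<open>r u\<close> in the equation
  is at most \<open>r x\<close>, so \<open>d\<close> is at most the degree; a neighbour of
  \<open>x\<close> makes \<open>d\<close> positive.\<close>

lemma obtain_structure_maximum:
  assumes "finite V" "V \<noteq> {}" "card V \<ge> 2" "cut_connected V w" and r: "r \<in> weight_structures V w"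
  obtains x d where "x \<in> V" "d > 0" "d \<le> (\<Sum>u\<in>V - {x}. w x u)"
    "r x * d = (\<Sum>u\<in>V - {x}. r u * w x u)"
proof -
  have "Max (r ` V) \<in> r ` V" using assms by simp
  then obtain x where x: "x \<in> V" "r x = Max (r ` V)" by auto
  have max: "r u \<le> r x" if "u \<in> V" for u using assms(1) x that by simp
  have pos: "r u > 0" if "u \<in> V" for u
    using r that by (auto simp: weight_structures_def)
  obtain d where d: "(\<Sum>u\<in>V - {x}. r u * w x u) = r x * d"
    using r x(1) by (auto simp: weight_structures_def dvd_def)
  have "V \<noteq> {x}" using assms(3) by auto
  then obtain v where v: "v \<in> V - {x}" "w x v > 0"
    using cut_connected_neighbour[OF assms(4) x(1)] by blast
  then have "0 < r v * w x v" using pos by simp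
  also have "\<dots> \<le> (\<Sum>u\<in>V - {x}. r u * w x u)"
    using v assms(1) by (intro member_le_sum) auto
  finally have "d > 0" using d by (cases "d = 0") auto
  have "r x * d \<le> (\<Sum>u\<in>V - {x}. r x * w x u)"
    unfolding d[symmetric] using max by (intro sum_mono mult_right_mono) auto
  then have "r x * d \<le> r x * (\<Sum>u\<in>V - {x}. w x u)" by (simp add: sum_distrib_left)
  then have "d \<le> (\<Sum>u\<in>V - {x}. w x u)" using pos[OF x(1)] by simp
  then show ?thesis using that x(1) \<open>d > 0\<close> d by metis
qed

text \<open>One elimination costs at most \<open>(k + 3) * m\<close> choices of
  \<open>(x, d)\<close> and replaces \<open>m\<close> by \<open>m\<^sup>2\<close>; the powers
  combine as \<open>m * (m\<^sup>2) ^ (2 ^ k - 1) = m ^ (2 ^ (k + 1) - 1)\<close>. The bound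
  \<open>T\<close> stays fixed since \<open>(m\<^sup>2) ^ 2 ^ k = m ^ 2 ^ (k + 1)\<close>.\<close>

lemma card_weight_structures_le:
  fixes w :: "'v \<Rightarrow> 'v \<Rightarrow> nat" and T :: real
  assumes "card V = k + 2" and sym: "\<And>u v. w u v = w v u" and "\<And>v. v \<in> V \<Longrightarrow> w v v = 0"
    and "cut_connected V w" and "(\<Sum>u\<in>V. \<Sum>v\<in>V. w u v) \<le> 2 * m"
    and "\<And>j. 0 < j \<Longrightarrow> j \<le> m ^ 2 ^ k \<Longrightarrow> real (card {e. e dvd j\<^sup>2}) \<le> T"
  shows "finite (weight_structures V w) \<and>
    2 * real (card (weight_structures V w)) \<le> fact (k + 2) * real m ^ (2 ^ k - 1) * T"
  using assms
proof (induction k arbitrary: V w m)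
  case 0
  from "0.prems"(1) have "card V = 2" by simp
  then obtain a b where V: "V = {a, b}" "a \<noteq> b" by (auto simp: card_2_iff)
  have "\<exists>u\<in>{a}. \<exists>v\<in>V - {a}. w u v > 0"
    using V by (intro cut_connectedD[OF "0.prems"(4)]) auto
  then have j: "w a b > 0" using V by auto
  have "2 * w a b \<le> (\<Sum>u\<in>V. \<Sum>v\<in>V. w u v)"
    using V "0.prems"(2)[of b a] by simp
  then have "w a b \<le> m" using "0.prems"(5) by simp
  then have "real (card {e. e dvd (w a b)\<^sup>2}) \<le> T" using "0.prems"(6) j by simp
  then show ?case
    using card_structures_two_vertices[OF V(2) "0.prems"(2) j] V by simp
next
  case (Suc k)
  note sym = Suc.prems(2) and diag = Suc.prems(3) and conn = Suc.prems(4)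
    and total = Suc.prems(5) and T = Suc.prems(6)
  let ?D = "\<lambda>x. \<Sum>u\<in>V - {x}. w x u"
  define I where "I = (SIGMA x:V. {0<..?D x})"
  define B where "B = (\<lambda>(x, d). {r \<in> weight_structures V w. r x * d = (\<Sum>u\<in>V - {x}. r u * w x u)})"
  define K where "K = fact (k + 2) * real (m\<^sup>2) ^ (2 ^ k - 1) * T / 2"
  have fin: "finite V" using Suc.prems(1) by (simp add: card_ge_0_finite)
  have ne: "V \<noteq> {}" using Suc.prems(1) by auto
  have finI: "finite I" unfolding I_def using fin by auto
  have m: "m > 0"
  proof (rule ccontr)
    assume "\<not> m > 0"
    then have zero: "w u v = 0" if "u \<in> V" "v \<in> V" for u v using total fin that by simp
    obtain a where "a \<in> V" using ne by blast
    moreover have "V \<noteq> {a}" using Suc.prems(1) by auto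
    ultimately obtain v where "v \<in> V - {a}" "w a v > 0"
      using cut_connected_neighbour[OF conn] by blast
    then show False using zero[of a v] \<open>a \<in> V\<close> by simp
  qed
  have "card {e. e dvd (1::nat)\<^sup>2} = 1" by simp
  then have T0: "T \<ge> 0" using T[of 1] m by simp
  have step: "finite (B i) \<and> real (card (B i)) \<le> K" if iI: "i \<in> I" for i
  proof -
    obtain x d where i: "i = (x, d)" "x \<in> V" "d > 0" "d \<le> ?D x"
      using iI by (auto simp: I_def)
    let ?W = "weight_structures (V - {x}) (eliminate w x d)"
    have "finite ?W \<and> 2 * real (card ?W) \<le> fact (k + 2) * real (m\<^sup>2) ^ (2 ^ k - 1) * T"
    proof (rule Suc.IH)
      show "card (V - {x}) = k + 2" using Suc.prems(1) i by simp
      show "eliminate w x d u v = eliminate w x d v u" for u v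
        using sym by (simp add: eliminate_def)
      show "cut_connected (V - {x}) (eliminate w x d)"
        using conn i by (intro cut_connected_eliminate) auto
      show "(\<Sum>u\<in>V - {x}. \<Sum>v\<in>V - {x}. eliminate w x d u v) \<le> 2 * m\<^sup>2"
        using fin i sym diag total by (intro sum_eliminate_le) auto
      show "real (card {e. e dvd j\<^sup>2}) \<le> T" if "0 < j" "j \<le> m\<^sup>2 ^ 2 ^ k" for j
        using T that by (simp add: power_mult[symmetric] mult.commute)
    qed (simp add: eliminate_def)
    moreover have "V \<noteq> {x}" using Suc.prems(1) by auto
    ultimately show ?thesis
      using card_structures_le_eliminate[of V x d w] fin i sym by (force simp: B_def K_def)
  qed
  have sub: "weight_structures V w \<subseteq> (\<Union>i\<in>I. B i)"
  proof
    fix r assume r: "r \<in> weight_structures V w"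
    have "card V \<ge> 2" using Suc.prems(1) by simp
    then obtain x d where "x \<in> V" "d > 0" "d \<le> ?D x" "r x * d = (\<Sum>u\<in>V - {x}. r u * w x u)"
      using obtain_structure_maximum[OF fin ne _ conn r] by blast
    then have "(x, d) \<in> I" "r \<in> B (x, d)" using r by (simp_all add: I_def B_def)
    then show "r \<in> (\<Union>i\<in>I. B i)" by blast
  qed
  have finU: "finite (\<Union>i\<in>I. B i)" using finI step by blast
  have "real (card (weight_structures V w)) \<le> real (card (\<Union>i\<in>I. B i))"
    using sub finU by (simp add: card_mono)
  also have "\<dots> \<le> real (\<Sum>i\<in>I. card (B i))"
    using card_UN_le[OF finI] by (simp only: of_nat_le_iff)
  also have "\<dots> = (\<Sum>i\<in>I. real (card (B i)))" by simp
  also have "\<dots> \<le> real (card I) * K" using step by (intro sum_bounded_above) auto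
  also have "\<dots> \<le> real ((k + 3) * m) * K"
  proof (rule mult_right_mono)
    have "card I = (\<Sum>x\<in>V. ?D x)" unfolding I_def using fin by (simp add: card_SigmaI)
    \<comment> \<open>Only the degree bound is wanted here, and \<open>d = 0\<close> trivially meets
      the premise on \<open>d\<close>.\<close>
    also have "\<dots> \<le> (\<Sum>x\<in>V. m)"
      using fin sym diag total by (intro sum_mono sum_eliminate_le(2)[where d = 0]) auto
    also have "\<dots> = (k + 3) * m" using Suc.prems(1) by (simp add: algebra_simps)
    finally show "real (card I) \<le> real ((k + 3) * m)" by (simp only: of_nat_le_iff)
    show "K \<ge> 0" unfolding K_def using T0 by simp
  qed
  finally have "2 * real (card (weight_structures V w)) \<le> real ((k + 3) * m) * (2 * K)" by simp
  also have "\<dots> = (real (k + 3) * fact (k + 2)) * (real m * real (m\<^sup>2) ^ (2 ^ k - 1)) * T"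
    by (simp add: K_def)
  also have "real (k + 3) * fact (k + 2) = fact (Suc k + 2)" by (simp add: algebra_simps)
  also have "real m * real (m\<^sup>2) ^ (2 ^ k - 1) = real m ^ Suc (2 * (2 ^ k - 1))"
    by (simp add: power_mult)
  also have "Suc (2 * (2 ^ k - 1)) = 2 ^ Suc k - (1::nat)"
    using one_le_power[of "2::nat" k] unfolding power_Suc by linarith
  finally show ?case using finite_subset[OF sub finU] by blast
qed

section \<open>From multigraphs to weights, and the final bound\<close>

lemma (in loopless_multigraph) sum_edge_mult:
  "(\<Sum>u\<in>V. \<Sum>v\<in>V. edge_mult E ends u v) = 2 * card E"
proof -
  have "(\<Sum>u\<in>V. \<Sum>v\<in>V. edge_mult E ends u v) = (\<Sum>q\<in>V \<times> V. card {e \<in> E. ends e = {fst q, snd q}})"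
    unfolding edge_mult_def sum.cartesian_product by (simp only: split_def)
  also have "\<dots> = (\<Sum>e\<in>E. card {q \<in> V \<times> V. ends e = {fst q, snd q}})"
    using finite_V finite_E by (intro sum_multicount_gen) auto
  also have "\<dots> = (\<Sum>e\<in>E. 2)"
  proof (rule sum.cong)
    fix e assume e: "e \<in> E"
    obtain a b where ab: "ends e = {a, b}" "a \<noteq> b"
      using card_ends[OF e] by (auto simp: card_2_iff)
    have "a \<in> V" "b \<in> V" using ends_subset[OF e] ab(1) by auto
    then have "{q \<in> V \<times> V. ends e = {fst q, snd q}} = {(a, b), (b, a)}"
      unfolding ab(1) doubleton_eq_iff by (auto simp: prod_eq_iff)
    then show "card {q \<in> V \<times> V. ends e = {fst q, snd q}} = 2" using ab by simp
  qed simp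
  finally show ?thesis by simp
qed

lemma edge_mult_commute: "edge_mult E ends u v = edge_mult E ends v u"
  by (simp add: edge_mult_def insert_commute)

lemma (in loopless_multigraph) cut_connected_edge_mult:
  assumes "multigraph_connected V E ends"
  shows "cut_connected V (edge_mult E ends)"
  unfolding cut_connected_def
proof (intro allI impI, rule ccontr)
  fix S assume S: "S \<subseteq> V" "S \<noteq> {}" "S \<noteq> V"
    and no_edge: "\<not> (\<exists>u\<in>S. \<exists>v\<in>V - S. edge_mult E ends u v > 0)"
  obtain a b where ab: "a \<in> S" "b \<in> V - S" using S by blast
  then have "(a, b) \<in> {(x, y). \<exists>e\<in>E. ends e = {x, y}}\<^sup>*"
    using assms S by (auto simp: multigraph_connected_def)
  then have "b \<in> S"
  proof induction
    case (step y z)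
    then obtain e where e: "e \<in> E" "ends e = {y, z}" by auto
    then have "z \<in> V" using ends_subset by blast
    moreover have "edge_mult E ends y z > 0"
      unfolding edge_mult_def using e finite_E by (auto simp: card_gt_0_iff)
    ultimately show ?case using no_edge step.IH by blast
  qed (use ab in simp)
  then show False using ab by simp
qed

lemma arith_structures_weight_structures:
  "inj_on fst (arith_structures V E ends)"
  "fst ` arith_structures V E ends \<subseteq> weight_structures V (edge_mult E ends)"
proof -
  show "inj_on fst (arith_structures V E ends)"
  proof (rule inj_onI)
    fix p q assume pq: "p \<in> arith_structures V E ends" "q \<in> arith_structures V E ends" "fst p = fst q"
    obtain r d d' where rd: "p = (r, d)" "q = (r, d')" using pq(3) by (metis prod.collapse)
    have "d v = d' v" if "v \<in> V" for v
    proof -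
      have "r v * d v = r v * d' v" "r v > 0"
        using pq that by (auto simp: rd arith_structures_def)
      then show ?thesis by simp
    qed
    then have "d = d'"
      using pq by (intro extensionalityI[of _ V]) (auto simp: rd arith_structures_def PiE_def)
    then show "p = q" using rd by simp
  qed
  show "fst ` arith_structures V E ends \<subseteq> weight_structures V (edge_mult E ends)"
    by (auto simp: arith_structures_def weight_structures_def) (metis dvd_triv_left)
qed

theorem theorem1p1:
  fixes V :: "'v set" and E :: "'e set" and ends :: "'e \<Rightarrow> 'v set" and n m :: nat
  assumes "loopless_multigraph V E ends"
    and "multigraph_connected V E ends"
    and "n = card V"
    and "m = card E"
  shows "finite (arith_structures V E ends) \<and>
    real (card (arith_structures V E ends)) \<le>
      fact n / 2 * real m powr (2 powr (real n - 2) - 1)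
      * real m powr (2 powr (real n - 1) *
          (1.538 * ln 2 / ((real n - 1) * ln 2 + ln (ln (real m)))))"
proof -
  interpret loopless_multigraph V E ends by (rule assms(1))
  let ?A = "arith_structures V E ends" and ?w = "edge_mult E ends"
  have "V \<noteq> {}" using assms(2) by (simp add: multigraph_connected_def)
  then have "n \<noteq> 0" using assms(3) finite_V by simp
  show ?thesis
  proof (cases "n = 1")
    case True
    then obtain v where V: "V = {v}" using assms(3) by (metis card_1_singletonE)
    \<comment> \<open>The sum over no neighbours is 0, but \<open>r v * d v\<close> is
      positive.\<close>
    have "?A = {}" by (auto simp: arith_structures_def V)
    then show ?thesis by simp
  next
    case False
    then obtain k where n: "n = k + 2" using \<open>n \<noteq> 0\<close> 
      by (metis Suc_1 add.commute add_2_eq_Suc' not0_implies_Suc One_nat_def)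
    \<comment> \<open>This is \<open>ln (m ^ 2 ^ k)\<close>, and \<open>ln (2 * ?Y)\<close> is
      exactly the denominator in the claimed exponent.\<close>
    let ?Y = "2 ^ k * ln (real m)"
    let ?X = "2 powr (real n - 1) * (1.538 * ln 2 / ((real n - 1) * ln 2 + ln (ln (real m))))"
    have bound: "real (card {e. e dvd j\<^sup>2}) \<le> real m powr ?X" if j: "0 < j" "j \<le> m ^ 2 ^ k" for j
    proof (cases "m \<ge> 2")
      case True
      have lnm: "ln 2 \<le> ln (real m)" using True by (subst ln_le_cancel_iff) auto
      then have lnm0: "ln (real m) > 0" using ln_2_bounds by linarith
      have "1 * ln 2 \<le> 2 ^ k * ln (real m)" using lnm by (intro mult_mono) auto
      then have Y: "ln 2 \<le> ?Y" by simp
      have "real j \<le> real (m ^ 2 ^ k)" using j(2) by (simp only: of_nat_le_iff)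
      then have "ln (real j) \<le> ln (real (m ^ 2 ^ k))" using j(1) by (intro ln_mono) auto
      also have "\<dots> = ?Y" using True by (simp add: ln_realpow)
      finally have "ln (real j) \<le> ?Y" .
      note main = ln_card_divisors_square_mult_ln_le[OF j(1) this Y]
      have "ln 2 + ln 2 \<le> 2 * ?Y" using Y by simp
      then have lnY: "ln (2 * ?Y) > 0" using ln_2_bounds by (intro ln_gt_zero) linarith
      have "2 * ?Y = 2 ^ (k + 1) * ln (real m)" by simp
      then have "ln (2 * ?Y) = ln (2 ^ (k + 1)) + ln (ln (real m))"
        using lnm0 by (simp only: ln_mult) simp
      also have "ln (2 ^ (k + 1) :: real) = (real n - 1) * ln 2"
        by (simp only: ln_realpow zero_less_numeral n) simp
      finally have den: "ln (2 * ?Y) = (real n - 1) * ln 2 + ln (ln (real m))" .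
      have pow: "2 powr (real n - 1) = 2 * 2 ^ k"
        using powr_realpow[of 2 "k + 1"] n by simp
      have "ln (real (card {e. e dvd j\<^sup>2})) \<le> 2 * 1.538 * ln 2 * ?Y / ln (2 * ?Y)"
        using main lnY by (simp add: pos_le_divide_eq)
      also have "\<dots> = ?X * ln (real m)"
        unfolding den pow by (simp only: times_divide_eq_left times_divide_eq_right mult_ac)
      finally have "exp (ln (real (card {e. e dvd j\<^sup>2}))) \<le> exp (?X * ln (real m))"
        by (simp only: exp_le_cancel_iff)
      moreover have "real (card {e. e dvd j\<^sup>2}) > 0" using j by (auto simp: card_gt_0_iff)
      ultimately show ?thesis using True by (simp add: powr_def)
    next
      case False
      \<comment> \<open>Only \<open>m = 1\<close> remains. Then \<open>j = 1\<close> has a single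
        divisor, and \<open>1 powr ?X\<close> is 1 whatever value \<open>ln (ln 1)\<close>
        takes.\<close>
      have "m ^ 2 ^ k > 0" using j by linarith
      then have "m \<noteq> 0" by auto
      then have "m = 1" using False by simp
      then have "j = 1" using j by simp
      then show ?thesis using \<open>m = 1\<close> by simp
    qed
    have W: "finite (weight_structures V ?w) \<and>
        2 * real (card (weight_structures V ?w)) \<le> fact (k + 2) * real m ^ (2 ^ k - 1) * real m powr ?X"
      using assms(2-4) n
      by (intro card_weight_structures_le bound cut_connected_edge_mult)
        (auto simp: sum_edge_mult edge_mult_self intro: edge_mult_commute)
    \<comment> \<open>Connectedness with at least two vertices forces an edge; positivity of
      \<open>m\<close> then lets \<open>powr\<close> be rewritten as an ordinary power.\<close>
    obtain x where "x \<in> V" using \<open>V \<noteq> {}\<close> by blast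
    moreover have "V \<noteq> {x}" using assms(3) n by auto
    ultimately obtain v where "?w x v > 0"
      using cut_connected_neighbour[OF cut_connected_edge_mult[OF assms(2)]] by blast
    then have "E \<noteq> {}" by (auto simp: edge_mult_def)
    then have "m > 0" using assms(4) finite_E by (simp add: card_gt_0_iff)
    have "2 powr (real n - 2) - 1 = real (2 ^ k - 1)"
      using n by (simp add: powr_realpow of_nat_diff)
    then have exponent: "real m powr (2 powr (real n - 2) - 1) = real m ^ (2 ^ k - 1)"
      using \<open>m > 0\<close> by (simp only: powr_realpow of_nat_0_less_iff)
    note inj = arith_structures_weight_structures(1)[of V E ends]
      and img = arith_structures_weight_structures(2)[of V E ends]
    have "card ?A \<le> card (weight_structures V ?w)"
      using card_inj_on_le[OF inj img] W by blast
    then have "2 * real (card ?A) \<le> 2 * real (card (weight_structures V ?w))" by simp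
    also have "\<dots> \<le> fact n * real m ^ (2 ^ k - 1) * real m powr ?X" using W n by simp
    finally show ?thesis
      using inj_on_finite[OF inj img] W unfolding exponent by simp
  qed
qed

end
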